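(* Let $y\in\mathbb{R}_{\max}^n$. Then $$\{x\in\mathbb{R}_{\max}^n \mid x\prec_{\max}y\}=\mathrm{co}_{\max}\left(\{y^{(i)}\}_{i=1}^n\right),$$ where, with $y_{\min}=\min_{1\le j\le n}y_j$ and $y_{\max}=\max_{1\le j\le n}y_j$, the vector $y^{(i)}\in\mathbb{R}_{\max}^n$ has $i$-th entry equal to $y_{\max}$ and all other entries equal to $y_{\min}$.
   Context: Max algebra: $\mathbb{R}_{\max}$ denotes the semiring $(\mathbb{R}_{\ge 0},\oplus,\otimes)$ with $a\oplus b=\max(a,b)$ and $a\otimes b=ab$. $\mathbb{R}_{\max}^n$ is the set of column vectors of length $n$ with entries in $\mathbb{R}_{\ge0}$, and $M_n(\mathbb{R}_{\max})$ is the set of $n\times n$ matrices with entries in $\mathbb{R}_{\ge 0}$. Addition $\oplus$ of vectors and matrices is entrywise, scalars act by entrywise multiplication, and $(A\otimes B)_{i,j}=\max_k a_{i,k}b_{k,j}$ (likewise for matrix-vector products). Let $\mathbf{1}=(1,\dots,1)^T\in\mathbb{R}_{\max}^n$. A matrix $D\in M_n(\mathbb{R}_{\max})$ is max-doubly stochastic if $D\otimes\mathbf{1}=\mathbf{1}$ and $\mathbf{1}^T\otimes D=\mathbf{1}^T$. For $x,y\in\mathbb{R}_{\max}^n$, $x\prec_{\max}y$ means there is a max-doubly stochastic matrix $D$ with $x=D\otimes y$. For $S\subseteq\mathbb{R}_{\max}^n$, the max-convex hull $\mathrm{co}_{\max}(S)$ is the set of all finite max-convex combinations $\bigoplus_{i\in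 I}\alpha_i s_i$, where $I$ is a finite set, $s_i\in S$, $\alpha_i\in\mathbb{R}_{\max}$, and $\bigoplus_{i\in I}\alpha_i=1$. *)

theory Defs
  imports "HOL-Analysis.Finite_Cartesian_Product"
begin

text \<open>
  The carrier of max algebra is the set of nonnegative reals, represented inside \<^typ>\<open>real\<close>; vectors
  and matrices over it are the elements of \<open>real^'n\<close> and \<open>real^'n^'n\<close> in the sets below.
\<close>

definition rmax_vec :: "(real^'n) set" where
  "rmax_vec = {x. \<forall>i. 0 \<le> x $ i}"

definition rmax_mat :: "(real^'n^'m) set" where
  "rmax_mat = {A. \<forall>i j. 0 \<le> A $ i $ j}"

text \<open>
  The finite sum of max algebra. Inserting 0, the neutral element of \<open>max\<close> on nonnegative reals,
  gives the empty sum its value; on nonempty index sets and nonnegative families it has no effect.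
\<close>

definition max_sum :: "('i \<Rightarrow> real) \<Rightarrow> 'i set \<Rightarrow> real" where
  "max_sum f I = Max (insert 0 (f ` I))"

lemma max_sum_eq_Max:
  assumes "finite I" "I \<noteq> {}" "\<And>i. i \<in> I \<Longrightarrow> 0 \<le> f i"
  shows "max_sum f I = Max (f ` I)"
proof -
  have "0 \<le> Max (f ` I)"
    using assms by (metis Max_ge all_not_in_conv finite_imageI imageI order_trans)
  then show ?thesis
    using assms by (simp add: max_sum_def)
qed

definition max_mat_vec :: "real^'n^'m \<Rightarrow> real^'n \<Rightarrow> real^'m" (infixr "*\<^sub>\<otimes>" 75) where
  "A *\<^sub>\<otimes> x = (\<chi> i. max_sum (\<lambda>k. A $ i $ k * x $ k) UNIV)"

definition max_vec_mat :: "real^'m \<Rightarrow> real^'n^'m \<Rightarrow> real^'n" (infixl "\<^sub>\<otimes>*" 75) where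
  "x \<^sub>\<otimes>* A = (\<chi> j. max_sum (\<lambda>k. x $ k * A $ k $ j) UNIV)"

text \<open>The constant \<open>1 :: real^'n\<close> is the all-ones vector.\<close>

definition max_doubly_stochastic :: "real^'n^'n \<Rightarrow> bool" where
  "max_doubly_stochastic D \<longleftrightarrow> D \<in> rmax_mat \<and> D *\<^sub>\<otimes> 1 = 1 \<and> 1 \<^sub>\<otimes>* D = 1"

definition max_majorized :: "real^'n \<Rightarrow> real^'n \<Rightarrow> bool" (infix "\<prec>\<^sub>m\<^sub>a\<^sub>x" 50) where
  "x \<prec>\<^sub>m\<^sub>a\<^sub>x y \<longleftrightarrow> (\<exists>D. max_doubly_stochastic D \<and> x = D *\<^sub>\<otimes> y)"

text \<open>
  Finite families are indexed by finite sets of natural numbers, without loss of generality; a vector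
  may occur repeatedly in a combination. The hull is meant for subsets of \<^const>\<open>rmax_vec\<close>.
\<close>

definition co_max :: "(real^'n) set \<Rightarrow> (real^'n) set" where
  "co_max S = {x. \<exists>(I :: nat set) \<alpha> s. finite I \<and> (\<forall>i\<in>I. s i \<in> S) \<and> (\<forall>i\<in>I. 0 \<le> \<alpha> i) \<and>
     max_sum \<alpha> I = 1 \<and> x = (\<chi> k. max_sum (\<lambda>i. \<alpha> i * s i $ k) I)}"

definition vec_min :: "real^'n \<Rightarrow> real" where
  "vec_min y = Min (range (\<lambda>j. y $ j))"

definition vec_max :: "real^'n \<Rightarrow> real" where
  "vec_max y = Max (range (\<lambda>j. y $ j))"

definition peak_vec :: "real^'n \<Rightarrow> 'n \<Rightarrow> real^'n" where
  "peak_vec y i = (\<chi> j. if j = i then vec_max y else vec_min y)"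

end

theory Submission
  imports Defs
begin

text \<open>
  Both sides are equal to one explicit set: the vectors in the box \<open>[y\<^sub>m\<^sub>i\<^sub>n, y\<^sub>m\<^sub>a\<^sub>x]\<^sup>n\<close> of which at least
  one entry reaches \<open>y\<^sub>m\<^sub>a\<^sub>x\<close>.

  The box bounds hold for both because a row of a max-doubly stochastic matrix, like the coefficient
  family of a max-convex combination, lies in \<open>[0, 1]\<close> and attains the value 1: the weighted maximum
  is at most the greatest value and at least the value with weight 1. An entry reaches
  \<open>y\<^sub>m\<^sub>a\<^sub>x\<close> because, for a matrix \<open>D\<close>, the column at a position of \<open>y\<^sub>m\<^sub>a\<^sub>x\<close> in \<open>y\<close> attains 1 in some
  row; for a combination, some peak vector has coefficient 1.

  Conversely, both representations of a vector \<open>x\<close> of that set use the ratios \<open>x\<^sub>i / y\<^sub>m\<^sub>a\<^sub>x\<close>, which scale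
  \<open>y\<^sub>m\<^sub>a\<^sub>x\<close> down to \<open>x\<^sub>i\<close> and every smaller value to at most \<open>x\<^sub>i\<close>. The position where \<open>x\<close>
  reaches \<open>y\<^sub>m\<^sub>a\<^sub>x\<close> gives the combination its coefficient 1 and the matrix a row of ones, which puts a 1
  into every column. Every row gets a 1 in a column where \<open>y\<close> attains \<open>y\<^sub>m\<^sub>i\<^sub>n\<close>; there it does no
  harm, as no entry of \<open>x\<close> is below \<open>y\<^sub>m\<^sub>i\<^sub>n\<close>.
\<close>

lemma max_sum_upper:
  assumes "finite I" "i \<in> I"
  shows "f i \<le> max_sum f I"
  using assms by (simp add: max_sum_def)

lemma max_sum_le_iff:
  assumes "finite I"
  shows "max_sum f I \<le> c \<longleftrightarrow> 0 \<le> c \<and> (\<forall>i\<in>I. f i \<le> c)"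
  using assms by (auto simp: max_sum_def)

lemma max_sum_eqI:
  assumes "finite I" "i \<in> I" "f i = c" "0 \<le> c" "\<And>j. j \<in> I \<Longrightarrow> f j \<le> c"
  shows "max_sum f I = c"
  using assms max_sum_upper[of I i f] max_sum_le_iff[of I f c] by (auto intro: antisym)

lemma max_sum_attained:
  assumes "finite I" "max_sum f I \<noteq> 0"
  shows "\<exists>i\<in>I. f i = max_sum f I"
  using Max_in[of "insert 0 (f ` I)"] assms unfolding max_sum_def by auto

lemma max_sum_reindex: "max_sum f (h ` I) = max_sum (f \<circ> h) I"
  by (simp add: max_sum_def image_comp)

text \<open>
  A family of weights with maximum 1 lies in \<open>[0, 1]\<close> and attains 1, so it acts on nonnegative values as a kind of
  average, without leaving their range. Rows of stochastic matrices and coefficients of max-convex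
  combinations are instances.
\<close>

lemma weighted_max_sum_bounds:
  assumes fin: "finite I" and weights: "\<And>i. i \<in> I \<Longrightarrow> 0 \<le> \<alpha> i" "max_sum \<alpha> I = 1"
    and vals: "\<And>i. i \<in> I \<Longrightarrow> a \<le> v i" "\<And>i. i \<in> I \<Longrightarrow> v i \<le> b" and "0 \<le> a"
  shows "a \<le> max_sum (\<lambda>i. \<alpha> i * v i) I" "max_sum (\<lambda>i. \<alpha> i * v i) I \<le> b"
proof -
  obtain p where p: "p \<in> I" "\<alpha> p = 1"
    using max_sum_attained[of I \<alpha>] fin weights(2) by auto
  show "a \<le> max_sum (\<lambda>i. \<alpha> i * v i) I"
    using max_sum_upper[of I p "\<lambda>i. \<alpha> i * v i"] fin p vals(1)[of p] by simp
  have "\<alpha> i * v i \<le> b" if "i \<in> I" for i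
  proof -
    have "\<alpha> i \<le> 1"
      using max_sum_upper[of I i \<alpha>] fin that weights(2) by simp
    then have "\<alpha> i * v i \<le> 1 * v i"
      using vals(1)[OF that] \<open>0 \<le> a\<close> by (intro mult_right_mono) auto
    then show ?thesis using vals(2)[OF that] by simp
  qed
  moreover have "0 \<le> b"
    using vals(1)[OF p(1)] vals(2)[OF p(1)] \<open>0 \<le> a\<close> by simp
  ultimately show "max_sum (\<lambda>i. \<alpha> i * v i) I \<le> b"
    using fin by (simp add: max_sum_le_iff)
qed

lemma vec_min_le: "vec_min y \<le> y $ j"
  by (simp add: vec_min_def)

lemma le_vec_max: "y $ j \<le> vec_max y"
  by (simp add: vec_max_def)

lemma vec_min_attained: "\<exists>j. y $ j = vec_min y"
proof -
  have "vec_min y \<in> range (\<lambda>j. y $ j)"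
    unfolding vec_min_def by (rule Min_in) auto
  then show ?thesis by (auto intro: sym)
qed

lemma vec_max_attained: "\<exists>j. y $ j = vec_max y"
proof -
  have "vec_max y \<in> range (\<lambda>j. y $ j)"
    unfolding vec_max_def by (rule Max_in) auto
  then show ?thesis by (auto intro: sym)
qed

lemma vec_min_nonneg: "y \<in> rmax_vec \<Longrightarrow> 0 \<le> vec_min y"
  using vec_min_attained[of y] by (auto simp: rmax_vec_def dest: sym)

lemma vec_min_le_vec_max: "vec_min y \<le> vec_max y"
  using vec_min_le le_vec_max by (rule order_trans)

lemma max_doubly_stochastic_iff:
  "max_doubly_stochastic D \<longleftrightarrow> D \<in> rmax_mat \<and>
     (\<forall>i. max_sum (\<lambda>k. D $ i $ k) UNIV = 1) \<and> (\<forall>j. max_sum (\<lambda>k. D $ k $ j) UNIV = 1)"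
  by (simp add: max_doubly_stochastic_def max_mat_vec_def max_vec_mat_def vec_eq_iff)

definition box_reaching_max :: "real^'n \<Rightarrow> (real^'n) set" where
  "box_reaching_max y =
     {x. (\<forall>i. vec_min y \<le> x $ i \<and> x $ i \<le> vec_max y) \<and> (\<exists>q. x $ q = vec_max y)}"

lemma box_reaching_max_ratio:
  assumes y: "y \<in> rmax_vec" and x: "x \<in> box_reaching_max y"
  shows "0 \<le> x $ i" "0 \<le> x $ i / vec_max y" "x $ i / vec_max y \<le> 1"
    and "x $ i / vec_max y * vec_max y = x $ i"
proof -
  have b: "0 \<le> vec_min y" "vec_min y \<le> x $ i" "x $ i \<le> vec_max y"
    using x vec_min_nonneg[OF y] by (auto simp: box_reaching_max_def)
  then show "0 \<le> x $ i" "0 \<le> x $ i / vec_max y" "x $ i / vec_max y \<le> 1"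
    by (auto simp: divide_le_eq_1)
  \<comment> \<open>If \<open>y\<^sub>m\<^sub>a\<^sub>x = 0\<close>, the quotient has the default value 0, which is right because then \<open>x\<^sub>i = 0\<close>.\<close>
  show "x $ i / vec_max y * vec_max y = x $ i"
    using b by (cases "vec_max y = 0") auto
qed

lemma max_majorized_imp_box:
  assumes y: "y \<in> rmax_vec" and "x \<prec>\<^sub>m\<^sub>a\<^sub>x y"
  shows "x \<in> box_reaching_max y"
proof -
  obtain D where D: "D \<in> rmax_mat" "\<And>i. max_sum (\<lambda>k. D $ i $ k) UNIV = 1"
      "\<And>j. max_sum (\<lambda>k. D $ k $ j) UNIV = 1" and "x = D *\<^sub>\<otimes> y"
    using assms(2) by (auto simp: max_majorized_def max_doubly_stochastic_iff)
  then have x: "x $ i = max_sum (\<lambda>k. D $ i $ k * y $ k) UNIV" for i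
    by (simp add: max_mat_vec_def)
  have bounds: "vec_min y \<le> x $ i" "x $ i \<le> vec_max y" for i
    using weighted_max_sum_bounds[of UNIV "\<lambda>k. D $ i $ k" "vec_min y" "\<lambda>k. y $ k" "vec_max y"]
      D(1,2) vec_min_nonneg[OF y] vec_min_le[of y] le_vec_max[of y]
    by (auto simp: x rmax_mat_def)
  obtain m where m: "y $ m = vec_max y" using vec_max_attained by blast
  obtain q where q: "D $ q $ m = 1"
    using max_sum_attained[of UNIV "\<lambda>k. D $ k $ m"] D(3)[of m] by auto
  have "vec_max y \<le> x $ q"
    using max_sum_upper[of UNIV m "\<lambda>k. D $ q $ k * y $ k"] by (simp add: x m q)
  then have "x $ q = vec_max y" using bounds(2)[of q] by simp
  then show ?thesis using bounds by (auto simp: box_reaching_max_def)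
qed

text \<open>
  Let \<open>x\<close> reach \<open>y\<^sub>m\<^sub>a\<^sub>x\<close> at \<open>q\<close> and \<open>y\<close> reach \<open>y\<^sub>m\<^sub>i\<^sub>n\<close> at \<open>l\<close>. The matrix with ones in row \<open>q\<close> and in column \<open>l\<close>,
  and with \<open>x\<^sub>i / y\<^sub>m\<^sub>a\<^sub>x\<close> elsewhere in each row \<open>i\<close>, has a one in every row and column. Its row \<open>q\<close> takes
  \<open>y\<close> to \<open>y\<^sub>m\<^sub>a\<^sub>x = x\<^sub>q\<close>. Another row \<open>i\<close> takes the maximum of \<open>y\<^sub>m\<^sub>i\<^sub>n \<le> x\<^sub>i\<close> and scaled entries that are at most
  \<open>x\<^sub>i\<close>, one of which is \<open>x\<^sub>i\<close> itself if \<open>y\<^sub>m\<^sub>a\<^sub>x\<close> occurs outside column \<open>l\<close>; if it does not, then \<open>y\<close> is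
  constant and the term \<open>y\<^sub>m\<^sub>i\<^sub>n\<close> is already equal to \<open>x\<^sub>i\<close>.
\<close>

lemma box_imp_max_majorized:
  fixes x y :: "real^'n"
  assumes y: "y \<in> rmax_vec" and xbox: "x \<in> box_reaching_max y"
  shows "x \<prec>\<^sub>m\<^sub>a\<^sub>x y"
proof -
  note ratio = box_reaching_max_ratio[OF y xbox]
  have box: "vec_min y \<le> x $ i" "x $ i \<le> vec_max y" for i
    using xbox by (auto simp: box_reaching_max_def)
  obtain q where q: "x $ q = vec_max y" using xbox by (auto simp: box_reaching_max_def)
  obtain m where m: "y $ m = vec_max y" using vec_max_attained by blast
  obtain l where l: "y $ l = vec_min y" using vec_min_attained by blast
  define D :: "real^'n^'n"
    where "D = (\<chi> i j. if i = q \<or> j = l then 1 else x $ i / vec_max y)"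
  have D: "D $ i $ j = (if i = q \<or> j = l then 1 else x $ i / vec_max y)" for i j
    by (simp add: D_def)
  have "max_sum (\<lambda>k. D $ i $ k) UNIV = 1" for i
    by (rule max_sum_eqI[where i = l]) (auto simp: D ratio)
  moreover have "max_sum (\<lambda>k. D $ k $ j) UNIV = 1" for j
    by (rule max_sum_eqI[where i = q]) (auto simp: D ratio)
  moreover have "D \<in> rmax_mat" by (auto simp: rmax_mat_def D ratio)
  ultimately have "max_doubly_stochastic D" by (simp add: max_doubly_stochastic_iff)
  moreover have "max_sum (\<lambda>k. D $ i $ k * y $ k) UNIV = x $ i" for i
  proof (rule max_sum_eqI[where i = m])
    show "D $ i $ m * y $ m = x $ i"
    proof (cases "i = q \<or> m \<noteq> l")
      case True
      then show ?thesis using q ratio(4)[of i] by (auto simp: D m)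
    next
      case False
      then have "vec_min y = vec_max y" using m l by auto
      then show ?thesis using False m box[of i] by (auto simp: D)
    qed
    show "D $ i $ j * y $ j \<le> x $ i" for j
    proof -
      have "x $ i / vec_max y * y $ j \<le> x $ i / vec_max y * vec_max y"
        by (intro mult_left_mono le_vec_max ratio)
      then show ?thesis
        using q l le_vec_max[of y j] box(1)[of i] ratio(4)[of i] by (auto simp: D)
    qed
  qed (simp_all add: ratio)
  then have "x = D *\<^sub>\<otimes> y" by (simp add: max_mat_vec_def vec_eq_iff)
  ultimately show ?thesis unfolding max_majorized_def by blast
qed

lemma co_max_peaks_imp_box:
  assumes y: "y \<in> rmax_vec" and "x \<in> co_max (range (peak_vec y))"
  shows "x \<in> box_reaching_max y"
proof -
  obtain I :: "nat set" and \<alpha> s where I: "finite I" "\<And>i. i \<in> I \<Longrightarrow> s i \<in> range (peak_vec y)"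
      "\<And>i. i \<in> I \<Longrightarrow> 0 \<le> \<alpha> i" "max_sum \<alpha> I = 1"
      and "x = (\<chi> k. max_sum (\<lambda>i. \<alpha> i * s i $ k) I)"
    using assms(2) unfolding co_max_def by blast
  then have x: "x $ k = max_sum (\<lambda>i. \<alpha> i * s i $ k) I" for k by simp
  have s: "vec_min y \<le> s i $ k" "s i $ k \<le> vec_max y" if "i \<in> I" for i k
    using I(2)[OF that] vec_min_le_vec_max[of y] by (auto simp: peak_vec_def)
  have bounds: "vec_min y \<le> x $ k" "x $ k \<le> vec_max y" for k
    using weighted_max_sum_bounds[of I \<alpha> "vec_min y" "\<lambda>i. s i $ k" "vec_max y"]
      I s vec_min_nonneg[OF y] by (auto simp: x)
  obtain p where p: "p \<in> I" "\<alpha> p = 1"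
    using max_sum_attained[of I \<alpha>] I(1,4) by auto
  obtain q where "s p = peak_vec y q" using I(2)[OF p(1)] by auto
  then have "vec_max y \<le> x $ q"
    using max_sum_upper[of I p "\<lambda>i. \<alpha> i * s i $ q"] I(1) p by (simp add: x peak_vec_def)
  then have "x $ q = vec_max y" using bounds(2)[of q] by simp
  then show ?thesis using bounds by (auto simp: box_reaching_max_def)
qed

text \<open>
  An enumeration of the index type turns a family over it, such as the peak vectors, into one over
  natural numbers.
\<close>

lemma co_max_familyI:
  fixes \<alpha> :: "'i::finite \<Rightarrow> real"
  assumes "\<And>i. s i \<in> S" "\<And>i. 0 \<le> \<alpha> i" "max_sum \<alpha> UNIV = 1"
  shows "(\<chi> k. max_sum (\<lambda>i. \<alpha> i * s i $ k) UNIV) \<in> co_max S"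
proof -
  obtain h :: "nat \<Rightarrow> 'i" where "bij_betw h {0..<card (UNIV :: 'i set)} UNIV"
    using ex_bij_betw_nat_finite[of "UNIV :: 'i set"] by auto
  then have h: "UNIV = h ` {0..<card (UNIV :: 'i set)}" by (simp add: bij_betw_def)
  have reindex: "max_sum f UNIV = max_sum (f \<circ> h) {0..<card (UNIV :: 'i set)}" for f
    by (subst h) (rule max_sum_reindex)
  show ?thesis
    unfolding co_max_def
    using assms
    by (intro CollectI exI[of _ "{0..<card (UNIV :: 'i set)}"] exI[of _ "\<alpha> \<circ> h"] exI[of _ "s \<circ> h"])
      (auto simp: reindex o_def)
qed

text \<open>
  The coefficient of the \<open>j\<close>-th peak vector is \<open>x\<^sub>j / y\<^sub>m\<^sub>a\<^sub>x\<close>, so that this vector contributes \<open>x\<^sub>j\<close> at its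
  peak; elsewhere it contributes at most \<open>y\<^sub>m\<^sub>i\<^sub>n\<close>, which no entry of \<open>x\<close> falls below. The coefficient where
  \<open>x\<close> reaches \<open>y\<^sub>m\<^sub>a\<^sub>x\<close> is set to 1 separately for the case \<open>y\<^sub>m\<^sub>a\<^sub>x = 0\<close>, in which the quotient is 0.
\<close>

lemma box_imp_co_max_peaks:
  assumes y: "y \<in> rmax_vec" and xbox: "x \<in> box_reaching_max y"
  shows "x \<in> co_max (range (peak_vec y))"
proof -
  note ratio = box_reaching_max_ratio[OF y xbox]
  have box: "vec_min y \<le> x $ i" for i
    using xbox by (auto simp: box_reaching_max_def)
  obtain q where q: "x $ q = vec_max y" using xbox by (auto simp: box_reaching_max_def)
  define \<alpha> where "\<alpha> j = (if j = q then 1 else x $ j / vec_max y)" for j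
  have \<alpha>: "0 \<le> \<alpha> j" "\<alpha> j \<le> 1" "\<alpha> j * vec_max y = x $ j" for j
    using ratio[of j] q by (auto simp: \<alpha>_def)
  have "max_sum \<alpha> UNIV = 1"
    by (rule max_sum_eqI[where i = q]) (auto simp: \<alpha>, simp add: \<alpha>_def)
  then have "(\<chi> k. max_sum (\<lambda>j. \<alpha> j * peak_vec y j $ k) UNIV) \<in> co_max (range (peak_vec y))"
    by (intro co_max_familyI) (auto simp: \<alpha>)
  moreover have "max_sum (\<lambda>j. \<alpha> j * peak_vec y j $ k) UNIV = x $ k" for k
  proof (rule max_sum_eqI[where i = k])
    show "\<alpha> j * peak_vec y j $ k \<le> x $ k" for j
    proof (cases "j = k")
      case False
      have "\<alpha> j * vec_min y \<le> 1 * vec_min y"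
        by (intro mult_right_mono \<alpha> vec_min_nonneg[OF y])
      then show ?thesis using False box[of k] by (simp add: peak_vec_def)
    qed (simp add: peak_vec_def \<alpha>)
  qed (simp_all add: peak_vec_def \<alpha> ratio)
  ultimately show ?thesis by simp
qed

theorem theorem3p4:
  fixes y :: "real^'n"
  assumes "y \<in> rmax_vec"
  shows "{x \<in> rmax_vec. x \<prec>\<^sub>m\<^sub>a\<^sub>x y} = co_max (range (peak_vec y))"
proof -
  have "box_reaching_max y \<subseteq> rmax_vec"
    using box_reaching_max_ratio(1)[OF assms] by (auto simp: rmax_vec_def)
  then have "{x \<in> rmax_vec. x \<prec>\<^sub>m\<^sub>a\<^sub>x y} = box_reaching_max y"
    using max_majorized_imp_box[OF assms] box_imp_max_majorized[OF assms] by blast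
  also have "\<dots> = co_max (range (peak_vec y))"
    using co_max_peaks_imp_box[OF assms] box_imp_co_max_peaks[OF assms] by blast
  finally show ?thesis .
qed

end
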